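(* Let $n,d\ge 1$ be integers and let $\boldsymbol{x}_1,\dots,\boldsymbol{x}_n\in[0,1]^d$, where $x_{ij}$ denotes the $j$-th component of $\boldsymbol{x}_i$. Then the squared $L_2$ average squared discrepancy of these points satisfies $$ \bigl(D^{\mathrm{asd}}_2(\boldsymbol{x}_1,\dots,\boldsymbol{x}_n)\bigr)^2 = \frac1{3^d}-\frac2n\sum_{i=1}^n\prod_{j=1}^d\frac{1+2x_{ij}-2x_{ij}^2}{4}+\frac1{n^2}\sum_{i=1}^n\sum_{i'=1}^n\prod_{j=1}^d\frac{1-|x_{ij}-x_{i'j}|}{2}. $$
   Context: For points $\boldsymbol{x}_1,\dots,\boldsymbol{x}_n\in[0,1]^d$ and a measurable set $A\subset[0,1]^d$, the local discrepancy of $A$ is $$\delta(A;\boldsymbol{x}_1,\dots,\boldsymbol{x}_n)=\frac1n\sum_{i=1}^n \mathbf{1}\{\boldsymbol{x}_i\in A\}-|A|,$$ where $|\cdot|$ is Lebesgue measure. For $\boldsymbol{a}\in[0,1]^d$ let $[\boldsymbol{0},\boldsymbol{a})=\{\boldsymbol{x}\in[0,1]^d : 0\le x_j<a_j,\ 1\le j\le d\}$. The $L_2$ star discrepancy is $$D_2^*(\boldsymbol{x}_1,\dots,\boldsymbol{x}_n)=\biggl(\int_{[0,1]^d}\delta([\boldsymbol{0},\boldsymbol{a});\boldsymbol{x}_1,\dots,\boldsymbol{x}_n)^2\,d\boldsymbol{a}\biggr)^{1/2}.$$ For $u\subseteq\{1,\dots,d\}$ and each $i$, the partially reflected point $\boldsymbol{x}_i^u\in[0,1]^d$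 has components $x^u_{ij}=x_{ij}$ if $j\in u$ and $x^u_{ij}=1-x_{ij}$ if $j\notin u$. The $L_2$ average squared discrepancy $D_2^{\mathrm{asd}}\ge 0$ is defined by $$\bigl(D^{\mathrm{asd}}_2(\boldsymbol{x}_1,\dots,\boldsymbol{x}_n)\bigr)^2=\frac1{2^d}\sum_{u\subseteq\{1,\dots,d\}}D_2^*(\boldsymbol{x}_1^u,\dots,\boldsymbol{x}_n^u)^2.$$ *)

theory Defs
  imports "HOL-Analysis.Analysis"
begin

text \<open>Dimension \<open>d\<close> is the cardinality of the index type \<open>'d\<close>.  A list of \<open>n\<close> points is a function
  on \<open>nat\<close> of which only the values at \<open>1, ..., n\<close> are used (points may repeat).
  In \<^typ>\<open>real^'d\<close>, the constant \<open>1\<close> is the vector with all components equal to 1.\<close>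

abbreviation unit_cube :: "(real^'d) set" where
  "unit_cube \<equiv> cbox 0 1"

definition local_discrepancy :: "nat \<Rightarrow> (nat \<Rightarrow> real^'d) \<Rightarrow> (real^'d) set \<Rightarrow> real" where
  "local_discrepancy n x A =
     1 / real n * (\<Sum>i=1..n. indicator A (x i)) - measure lebesgue A"

definition anchored_box :: "real^'d \<Rightarrow> (real^'d) set" where
  "anchored_box a = {x \<in> unit_cube. \<forall>j. 0 \<le> x $ j \<and> x $ j < a $ j}"

definition L2_star_discrepancy :: "nat \<Rightarrow> (nat \<Rightarrow> real^'d) \<Rightarrow> real" where
  "L2_star_discrepancy n x =
     sqrt (LINT a:unit_cube|lebesgue. (local_discrepancy n x (anchored_box a))\<^sup>2)"

text \<open>Components with index in \<open>u\<close> are kept; all others are reflected.\<close>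

definition reflect_outside :: "'d set \<Rightarrow> real^'d \<Rightarrow> real^'d" where
  "reflect_outside u y = (\<chi> j. if j \<in> u then y $ j else 1 - y $ j)"

definition L2_asd :: "nat \<Rightarrow> (nat \<Rightarrow> real^'d) \<Rightarrow> real" where
  "L2_asd n x =
     sqrt (1 / 2 ^ CARD('d) *
       (\<Sum>u\<in>Pow (UNIV :: 'd set). (L2_star_discrepancy n (\<lambda>i. reflect_outside u (x i)))\<^sup>2))"

end

theory Submission
  imports Defs
begin

text \<open>
  Expanding the square writes the \<open>L\<^sub>2\<close> star discrepancy as a combination of integrals over
  the cube whose integrands are products of one-variable functions of the coordinates; by Fubini
  this gives Warnock's formula. Reflecting a coordinate only changes one factor of each product,
  and a sum over all subsets \<open>u\<close> of such products is a product of two-term sums.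
\<close>

text \<open>On \<open>real^'d\<close>, \<open>lborel\<close> is the image of a product measure
  indexed by \<open>Basis\<close>. The bijection between an index \<open>j\<close> and the basis
  vector \<open>axis j 1\<close>, with inverse \<open>k\<close> below, turns a product over
  coordinates into one over \<open>Basis\<close>, where the product form of Fubini applies.\<close>

lemma has_bochner_integral_lborel_prod_cart:
  fixes f :: "'d::finite \<Rightarrow> real \<Rightarrow> real"
  assumes f: "\<And>j. has_bochner_integral lborel (f j) (v j)"
  shows "has_bochner_integral lborel (\<lambda>a::real^'d. \<Prod>j\<in>UNIV. f j (a $ j)) (\<Prod>j\<in>UNIV. v j)"
proof -
  interpret product_sigma_finite "\<lambda>_::real^'d. lborel :: real measure" ..
  let ?B = "Basis :: (real^'d) set"
  let ?s = "\<lambda>g. \<Sum>b\<in>?B. g b *\<^sub>R b"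
  have Basis_eq: "?B = (\<lambda>j. axis j 1) ` UNIV"
    by (auto simp: Basis_vec_def)
  have inj: "inj (\<lambda>j::'d. axis j (1::real))"
    by (auto simp: inj_on_def axis_eq_axis)
  define k where "k = the_inv (\<lambda>j::'d. axis j (1::real))"
  have k: "k (axis j 1) = j" for j
    unfolding k_def by (rule the_inv_f_f[OF inj])
  have integrable: "integrable lborel (f j)" and value_eq: "integral\<^sup>L lborel (f j) = v j" for j
    using f[of j] by (auto simp: has_bochner_integral_iff)
  have [measurable]: "f j \<in> borel_measurable borel" for j
    using borel_measurable_integrable[OF integrable[of j]] by simp
  have comp: "?s g $ j = g (axis j 1)" for g j
  proof -
    have "?s g $ j = ?s g \<bullet> axis j 1"
      by (simp add: inner_axis)
    also have "\<dots> = g (axis j 1)"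
      by (subst inner_sum_left_Basis) (auto simp: Basis_eq)
    finally show ?thesis .
  qed
  have reindex: "(\<Prod>j\<in>UNIV. f j (?s g $ j)) = (\<Prod>b\<in>?B. f (k b) (g b))" for g
    by (simp only: comp) (simp add: Basis_eq prod.reindex[OF inj] k)
  have meas: "?s \<in> measurable (\<Pi>\<^sub>M b\<in>?B. lborel) borel"
    by measurable
  have "has_bochner_integral (\<Pi>\<^sub>M b\<in>?B. lborel) (\<lambda>g. \<Prod>b\<in>?B. f (k b) (g b))
      (\<Prod>b\<in>?B. v (k b))"
    using product_integrable_prod[of ?B "\<lambda>b. f (k b)"] product_integral_prod[of ?B "\<lambda>b. f (k b)"]
    by (simp add: has_bochner_integral_iff integrable value_eq)
  also have "(\<Prod>b\<in>?B. v (k b)) = (\<Prod>j\<in>UNIV. v j)"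
    unfolding Basis_eq by (subst prod.reindex[OF inj]) (simp add: k)
  finally show ?thesis
    by (subst lborel_eq, intro has_bochner_integral_distr[OF _ meas])
       (simp_all only: reindex, measurable)
qed

text \<open>These are all the one-variable integrals needed, with \<open>k\<close> = 0, 1, 2. The
  interval is open at \<open>c\<close> because membership in an anchored box demands the strict
  inequality \<open>c < t\<close>.\<close>

lemma has_bochner_integral_power_Ioc:
  fixes c :: real
  assumes "0 \<le> c" "c \<le> 1"
  shows "has_bochner_integral lborel (\<lambda>t. indicator {c<..1} t * t ^ k) ((1 - c ^ Suc k) / Suc k)"
proof -
  have "has_bochner_integral lborel (\<lambda>t. t ^ k * indicator {c..1} t)
      (1 ^ Suc k / Suc k - c ^ Suc k / Suc k)"
    using assms by (intro has_bochner_integral_FTC_Icc_nonneg)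
      (auto intro!: derivative_eq_intros simp del: power_Suc simp: zero_le_power)
  \<comment> \<open>The fundamental theorem is applied on a closed interval; it differs from the
    half-open one only in the null set \<open>{c}\<close>.\<close>
  moreover have "AE t in lborel. t ^ k * indicator {c..1} t = indicator {c<..1} t * t ^ k"
    using AE_lborel_singleton[of c] by eventually_elim (auto simp: indicator_def)
  ultimately show ?thesis
    by (subst has_bochner_integral_cong_AE[symmetric]) (auto simp: diff_divide_distrib)
qed

text \<open>The point \<open>y\<close> is held fixed and the corner \<open>a\<close> varies, since
  \<open>a\<close> is the variable of integration. The result has one factor per coordinate, as
  Fubini requires.\<close>

lemma indicator_anchored_box:
  assumes "y \<in> unit_cube"
  shows "indicator (anchored_box a) y = (\<Prod>j\<in>UNIV. indicator {y $ j<..} (a $ j) :: real)"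
  using assms by (auto simp: anchored_box_def mem_box_cart indicator_def)

lemma measure_anchored_box:
  fixes a :: "real^'d"
  assumes "a \<in> unit_cube"
  shows "measure lebesgue (anchored_box a) = (\<Prod>j\<in>UNIV. a $ j)"
proof -
  have a: "0 \<le> a $ j" "a $ j \<le> 1" for j
    using assms by (auto simp: mem_box_cart)
  have "has_bochner_integral lborel (indicator {0..<a $ j} :: real \<Rightarrow> real) (a $ j)" for j
    using has_bochner_integral_real_indicator[of "{0..<a $ j}" lborel] a[of j]
    by simp
  then have int: "has_bochner_integral lborel
      (\<lambda>y::real^'d. \<Prod>j\<in>UNIV. indicator {0..<a $ j} (y $ j) :: real) (\<Prod>j\<in>UNIV. a $ j)"
    by (rule has_bochner_integral_lborel_prod_cart)
  \<comment> \<open>As each \<open>a $ j\<close> is at most 1, the condition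
    \<open>y $ j < a $ j\<close> already keeps \<open>y\<close> inside the cube.\<close>
  also have "(\<lambda>y::real^'d. \<Prod>j\<in>UNIV. indicator {0..<a $ j} (y $ j) :: real) = indicator (anchored_box a)"
    using a by (force simp: anchored_box_def mem_box_cart indicator_def fun_eq_iff
        intro: order.trans[OF less_imp_le])
  finally have int: "has_bochner_integral lborel
      (indicator (anchored_box a) :: real^'d \<Rightarrow> real) (\<Prod>j\<in>UNIV. a $ j)" .
  then have "(indicator (anchored_box a) :: real^'d \<Rightarrow> real) \<in> borel_measurable lborel"
    by (auto simp: has_bochner_integral_iff)
  then have "anchored_box a \<in> sets lborel"
    by (simp add: borel_measurable_indicator_iff)
  with int show ?thesis
    by (simp add: has_bochner_integral_iff measure_completion)
qed

text \<open>This lets integrals over the cube be taken over the whole space: some coordinate of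
  \<open>a\<close> lies outside [0,1], so its factor vanishes.\<close>

lemma prod_indicator_Ioc_eq_0:
  fixes a :: "real^'d" and c :: "'d \<Rightarrow> real"
  assumes "a \<notin> unit_cube" "\<And>j. 0 \<le> c j"
  shows "(\<Prod>j\<in>UNIV. indicator {c j<..1} (a $ j) * a $ j ^ k) = 0"
proof -
  obtain j where "a $ j < 0 \<or> a $ j > 1"
    using assms(1) by (auto simp: mem_box_cart not_le)
  then have "indicator {c j<..1} (a $ j) * a $ j ^ k = 0"
    using assms(2)[of j] by (auto simp: indicator_def)
  then show ?thesis
    by (auto intro!: prod_zero)
qed

text \<open>With \<open>I i\<close> the indicator and \<open>V\<close> the volume, the square
  consists of the terms \<open>V\<^sup>2\<close>, \<open>I i * V\<close> and
  \<open>I i * I i'\<close>. The exponents 2, 1, 0 count the factors \<open>V\<close>; the maximum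
  appears because both points lie in the box iff in each coordinate the larger entry is below
  \<open>a $ j\<close>. Trivial powers are kept so that one integral formula serves all three
  terms.\<close>

lemma local_discrepancy_square_expand:
  fixes x :: "nat \<Rightarrow> real^'d"
  assumes x: "x ` {1..n} \<subseteq> unit_cube"
  shows "indicator unit_cube a * (local_discrepancy n x (anchored_box a))\<^sup>2 =
      (\<Prod>j\<in>UNIV. indicator {0<..1} (a $ j) * a $ j ^ 2)
      - 2 / real n * (\<Sum>i=1..n. \<Prod>j\<in>UNIV. indicator {x i $ j<..1} (a $ j) * a $ j ^ 1)
      + 1 / (real n)\<^sup>2 * (\<Sum>i=1..n. \<Sum>i'=1..n.
          \<Prod>j\<in>UNIV. indicator {max (x i $ j) (x i' $ j)<..1} (a $ j) * a $ j ^ 0)"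
proof (cases "a \<in> unit_cube")
  case True
  define I where "I i = (indicator (anchored_box a) (x i) :: real)" for i
  define V where "V = (\<Prod>j\<in>UNIV. a $ j)"
  have a: "0 \<le> a $ j" "a $ j \<le> 1" for j
    using True by (auto simp: mem_box_cart)
  have I: "I i = (\<Prod>j\<in>UNIV. indicator {x i $ j<..} (a $ j))" if "i \<in> {1..n}" for i
    using x that by (auto simp add: image_subset_iff I_def indicator_anchored_box)
  \<comment> \<open>Leaving out the endpoint 0 is harmless, as the square vanishes there.\<close>
  have "(\<Prod>j\<in>UNIV. indicator {0<..1} (a $ j) * a $ j ^ 2) = (\<Prod>j\<in>UNIV. a $ j ^ 2)"
    using a by (intro prod.cong) (auto simp: indicator_def order.order_iff_strict)
  then have 2: "(\<Prod>j\<in>UNIV. indicator {0<..1} (a $ j) * a $ j ^ 2) = V\<^sup>2"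
    by (simp add: V_def prod_power_distrib)
  have 1: "(\<Prod>j\<in>UNIV. indicator {x i $ j<..1} (a $ j) * a $ j ^ 1) = I i * V"
    if "i \<in> {1..n}" for i
    unfolding I[OF that] V_def prod.distrib[symmetric]
    using a by (intro prod.cong) (auto simp: indicator_def)
  have 0: "(\<Prod>j\<in>UNIV. indicator {max (x i $ j) (x i' $ j)<..1} (a $ j) * a $ j ^ 0) = I i * I i'"
    if "i \<in> {1..n}" "i' \<in> {1..n}" for i i'
    unfolding I[OF that(1)] I[OF that(2)] prod.distrib[symmetric]
    using a by (intro prod.cong) (auto simp: indicator_def)
  have "(\<Sum>i=1..n. \<Prod>j\<in>UNIV. indicator {x i $ j<..1} (a $ j) * a $ j ^ 1) = (\<Sum>i=1..n. I i) * V"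
    unfolding sum_distrib_right by (intro sum.cong refl 1)
  moreover have "(\<Sum>i=1..n. \<Sum>i'=1..n.
      \<Prod>j\<in>UNIV. indicator {max (x i $ j) (x i' $ j)<..1} (a $ j) * a $ j ^ 0) = (\<Sum>i=1..n. I i)\<^sup>2"
    unfolding power2_eq_square sum_product by (intro sum.cong refl 0)
  moreover have "indicator unit_cube a * (local_discrepancy n x (anchored_box a))\<^sup>2 =
      (1 / real n * (\<Sum>i=1..n. I i) - V)\<^sup>2"
    using True by (simp add: local_discrepancy_def measure_anchored_box I_def V_def)
  ultimately show ?thesis
    unfolding 2 by (simp add: power2_eq_square algebra_simps)
next
  case False
  have "0 \<le> x i $ j" if "i \<in> {1..n}" for i j
    using x that by (auto simp: image_subset_iff mem_box_cart)
  then have "(\<Sum>i=1..n. \<Prod>j\<in>UNIV. indicator {x i $ j<..1} (a $ j) * a $ j ^ 1) = 0"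
    "(\<Sum>i=1..n. \<Sum>i'=1..n.
        \<Prod>j\<in>UNIV. indicator {max (x i $ j) (x i' $ j)<..1} (a $ j) * a $ j ^ 0) = 0"
    "(\<Prod>j\<in>UNIV. indicator {0<..1} (a $ j) * a $ j ^ 2) = 0"
    by (intro sum.neutral ballI prod_indicator_Ioc_eq_0[OF False]; auto simp: le_max_iff_disj)+
  then show ?thesis
    using False by simp
qed

theorem L2_star_discrepancy_square:
  fixes x :: "nat \<Rightarrow> real^'d"
  assumes x: "x ` {1..n} \<subseteq> unit_cube"
  shows "(L2_star_discrepancy n x)\<^sup>2 =
      1 / 3 ^ CARD('d)
      - 2 / real n * (\<Sum>i=1..n. \<Prod>j\<in>UNIV. (1 - (x i $ j)\<^sup>2) / 2)
      + 1 / (real n)\<^sup>2 * (\<Sum>i=1..n. \<Sum>i'=1..n. \<Prod>j\<in>UNIV. 1 - max (x i $ j) (x i' $ j))"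
    (is "_ = ?R")
proof -
  define F where "F a = indicator unit_cube a * (local_discrepancy n x (anchored_box a))\<^sup>2" for a
  have x01: "0 \<le> x i $ j" "x i $ j \<le> 1" if "i \<in> {1..n}" for i j
    using x that by (auto simp: image_subset_iff mem_box_cart)
  have p: "has_bochner_integral lborel (\<lambda>a::real^'d. \<Prod>j\<in>UNIV. indicator {c j<..1} (a $ j) * a $ j ^ k)
      (\<Prod>j\<in>UNIV. (1 - c j ^ Suc k) / Suc k)" if "\<And>j. 0 \<le> c j \<and> c j \<le> 1" for c k
    using that by (intro has_bochner_integral_lborel_prod_cart has_bochner_integral_power_Ioc) auto
  have "has_bochner_integral lborel F
     ((\<Prod>j\<in>(UNIV::'d set). (1 - 0 ^ Suc 2) / Suc 2)
      - 2 / real n * (\<Sum>i=1..n. \<Prod>j\<in>UNIV. (1 - x i $ j ^ Suc 1) / Suc 1)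
      + 1 / (real n)\<^sup>2 * (\<Sum>i=1..n. \<Sum>i'=1..n.
          \<Prod>j\<in>UNIV. (1 - max (x i $ j) (x i' $ j) ^ Suc 0) / Suc 0))"
    unfolding F_def local_discrepancy_square_expand[OF x]
    by (intro has_bochner_integral_add has_bochner_integral_diff has_bochner_integral_mult_right
        has_bochner_integral_sum p) (auto simp: x01 le_max_iff_disj)
  also have "\<dots> = ?R"
    by (simp add: power_one_over power2_eq_square)
  finally have F: "has_bochner_integral lborel F ?R" .
  then have "F \<in> borel_measurable lborel"
    by (auto simp: has_bochner_integral_iff)
  \<comment> \<open>The discrepancy is defined with \<open>lebesgue\<close>, the completion of
    \<open>lborel\<close>; for the Borel function \<open>F\<close> the two integrals agree.\<close>
  with F have "(LINT a|lebesgue. F a) = ?R"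
    by (subst integral_completion) (auto simp: has_bochner_integral_iff)
  \<comment> \<open>Nonnegativity is what allows squaring to undo the \<open>sqrt\<close> in the
    definition.\<close>
  moreover have "0 \<le> (LINT a|lebesgue. F a)"
    by (intro Bochner_Integration.integral_nonneg) (simp add: F_def)
  ultimately show ?thesis
    by (simp add: L2_star_discrepancy_def set_lebesgue_integral_def F_def)
qed

text \<open>Multiplying out the right-hand side, \<open>u\<close> records the indices at which the
  summand \<open>f j\<close> is chosen.\<close>

lemma sum_Pow_prod_if:
  fixes f g :: "'d::finite \<Rightarrow> 'a::comm_semiring_1"
  shows "(\<Sum>u\<in>Pow UNIV. \<Prod>j\<in>UNIV. if j \<in> u then f j else g j) = (\<Prod>j\<in>UNIV. f j + g j)"
  by (simp add: prod_add prod.If_cases Compl_eq_Diff_UNIV)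

theorem theorem1:
  fixes n :: nat and x :: "nat \<Rightarrow> real^'d"
  assumes "n \<ge> 1"
    and "\<And>i. i \<in> {1..n} \<Longrightarrow> x i \<in> unit_cube"
  shows "(L2_asd n x)\<^sup>2 =
      1 / 3 ^ CARD('d)
      - 2 / real n * (\<Sum>i=1..n. \<Prod>j\<in>UNIV. (1 + 2 * x i $ j - 2 * (x i $ j)\<^sup>2) / 4)
      + 1 / (real n)\<^sup>2 *
        (\<Sum>i=1..n. \<Sum>i'=1..n. \<Prod>j\<in>UNIV. (1 - \<bar>x i $ j - x i' $ j\<bar>) / 2)"
proof -
  let ?r = "\<lambda>u i. reflect_outside u (x i)"
  let ?P = "Pow (UNIV :: 'd set)"
  define N where "N = (2::real) ^ CARD('d)"
  \<comment> \<open>Written as a product, \<open>N\<close> supplies one factor 2 per coordinate, so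
    averaging over \<open>u\<close> becomes averaging each factor over its two reflections.\<close>
  have N: "N = (\<Prod>j\<in>(UNIV::'d set). 2)"
    by (simp add: N_def)
  have r: "?r u ` {1..n} \<subseteq> unit_cube" for u
    using assms(2) by (auto simp: reflect_outside_def mem_box_cart)
  have single: "1 / N * (\<Sum>u\<in>?P. \<Prod>j\<in>UNIV. (1 - (?r u i $ j)\<^sup>2) / 2) =
      (\<Prod>j\<in>UNIV. (1 + 2 * x i $ j - 2 * (x i $ j)\<^sup>2) / 4)" for i
  proof -
    have "(\<Sum>u\<in>?P. \<Prod>j\<in>UNIV. (1 - (?r u i $ j)\<^sup>2) / 2) =
        (\<Sum>u\<in>?P. \<Prod>j\<in>UNIV. if j \<in> u then (1 - (x i $ j)\<^sup>2) / 2 else (1 - (1 - x i $ j)\<^sup>2) / 2)"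
      by (intro sum.cong prod.cong) (auto simp: reflect_outside_def)
    also have "\<dots> = (\<Prod>j\<in>UNIV. (1 - (x i $ j)\<^sup>2) / 2 + (1 - (1 - x i $ j)\<^sup>2) / 2)"
      by (rule sum_Pow_prod_if)
    also have "\<dots> = (\<Prod>j\<in>UNIV. 2 * ((1 + 2 * x i $ j - 2 * (x i $ j)\<^sup>2) / 4))"
      by (intro prod.cong) (auto simp: power2_eq_square field_simps)
    finally show ?thesis
      unfolding N by (simp only: prod.distrib) simp
  qed
  have pair: "1 / N * (\<Sum>u\<in>?P. \<Prod>j\<in>UNIV. 1 - max (?r u i $ j) (?r u i' $ j)) =
      (\<Prod>j\<in>UNIV. (1 - \<bar>x i $ j - x i' $ j\<bar>) / 2)" for i i'
  proof -
    have "(\<Sum>u\<in>?P. \<Prod>j\<in>UNIV. 1 - max (?r u i $ j) (?r u i' $ j)) =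
        (\<Sum>u\<in>?P. \<Prod>j\<in>UNIV. if j \<in> u then 1 - max (x i $ j) (x i' $ j)
          else 1 - max (1 - x i $ j) (1 - x i' $ j))"
      by (intro sum.cong prod.cong) (auto simp: reflect_outside_def)
    also have "\<dots> = (\<Prod>j\<in>UNIV. 1 - max (x i $ j) (x i' $ j) + (1 - max (1 - x i $ j) (1 - x i' $ j)))"
      by (rule sum_Pow_prod_if)
    \<comment> \<open>Here \<open>1 - max (1 - s) (1 - t) = min s t\<close>, and
      \<open>max s t - min s t\<close> is the absolute difference of \<open>s\<close> and
      \<open>t\<close>.\<close>
    also have "\<dots> = (\<Prod>j\<in>UNIV. 1 - \<bar>x i $ j - x i' $ j\<bar>)"
      by (intro prod.cong) auto
    finally show ?thesis
      unfolding N by (simp add: prod_dividef)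
  qed
  have card: "real (card ?P) = N"
    by (simp add: N_def card_Pow)
  have "(L2_asd n x)\<^sup>2 = 1 / N * (\<Sum>u\<in>?P. (L2_star_discrepancy n (?r u))\<^sup>2)"
    by (simp add: L2_asd_def N_def sum_nonneg)
  also have "\<dots> = 1 / N * (\<Sum>u\<in>?P. 1 / 3 ^ CARD('d)
      - 2 / real n * (\<Sum>i=1..n. \<Prod>j\<in>UNIV. (1 - (?r u i $ j)\<^sup>2) / 2)
      + 1 / (real n)\<^sup>2 *
        (\<Sum>i=1..n. \<Sum>i'=1..n. \<Prod>j\<in>UNIV. 1 - max (?r u i $ j) (?r u i' $ j)))"
    using r by (simp add: L2_star_discrepancy_square)
  \<comment> \<open>The first term does not depend on \<open>u\<close>, so summing over the
    \<open>N\<close> subsets multiplies it by \<open>N\<close>. In the other two, the sum over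
    \<open>u\<close> is then moved innermost to match \<open>single\<close> and
    \<open>pair\<close>.\<close>
  also have "\<dots> = 1 / N * (N * (1 / 3 ^ CARD('d)))
      - 2 / real n * (1 / N * (\<Sum>u\<in>?P. \<Sum>i=1..n. \<Prod>j\<in>UNIV. (1 - (?r u i $ j)\<^sup>2) / 2))
      + 1 / (real n)\<^sup>2 * (1 / N * (\<Sum>u\<in>?P. \<Sum>i=1..n. \<Sum>i'=1..n.
          \<Prod>j\<in>UNIV. 1 - max (?r u i $ j) (?r u i' $ j)))"
    by (simp only: sum.distrib sum_subtractf sum_distrib_left[symmetric] sum_constant card)
       (simp add: algebra_simps)
  also have "(\<Sum>u\<in>?P. \<Sum>i=1..n. \<Prod>j\<in>UNIV. (1 - (?r u i $ j)\<^sup>2) / 2) =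
      (\<Sum>i=1..n. \<Sum>u\<in>?P. \<Prod>j\<in>UNIV. (1 - (?r u i $ j)\<^sup>2) / 2)"
    by (rule sum.swap)
  also have "(\<Sum>u\<in>?P. \<Sum>i=1..n. \<Sum>i'=1..n. \<Prod>j\<in>UNIV. 1 - max (?r u i $ j) (?r u i' $ j)) =
      (\<Sum>i=1..n. \<Sum>i'=1..n. \<Sum>u\<in>?P. \<Prod>j\<in>UNIV. 1 - max (?r u i $ j) (?r u i' $ j))"
    by (subst sum.swap, intro sum.cong refl, rule sum.swap)
  also have "1 / N * (N * (1 / 3 ^ CARD('d))) = 1 / 3 ^ CARD('d)"
    by (simp add: N_def)
  finally show ?thesis
    by (simp only: single[symmetric] pair[symmetric] sum_distrib_left)
qed

end
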